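(* Let $G$ be a finite $A$-group whose order is divisible by at most two different primes. Then $G$ is an $A'$-group.
   Context: An $A$-group is a finite group all of whose Sylow subgroups are abelian. The class of $A'$-groups is the class of finite groups defined inductively (up to isomorphism) by the following rules: (1) Finite abelian groups are $A'$-groups. (2) If $\mathcal G$ is an $A'$-group and $H$ is a finite abelian group of order prime to that of $\mathcal G$, then the semidirect product $H\rtimes_\mu \mathcal G$ is an $A'$-group, for any action $\mu$ of $\mathcal G$ on $H$ (by group automorphisms). (3) If $\mathcal G_1$ and $\mathcal G_2$ are $A'$-groups, then $\mathcal G_1\times \mathcal G_2$ is an $A'$-group. A group is an $A'$-group only if it is obtained by finitely many applications of these rules. *)

theory Defs
  imports "HOL-Algebra.Algebra"
begin

definition sylow_subgroup :: "nat \<Rightarrow> 'a set \<Rightarrow> ('a, 'b) monoid_scheme \<Rightarrow> bool"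
  where "sylow_subgroup p P G \<longleftrightarrow>
    Factorial_Ring.prime p \<and> subgroup P G \<and> card P = p ^ multiplicity p (order G)"

definition A_group :: "('a, 'b) monoid_scheme \<Rightarrow> bool"
  where "A_group G \<longleftrightarrow> group G \<and> finite (carrier G) \<and>
    (\<forall>p P. sylow_subgroup p P G \<longrightarrow> comm_group (G\<lparr>carrier := P\<rparr>))"

definition semidirect_product ::
    "('a, 'c) monoid_scheme \<Rightarrow> ('b \<Rightarrow> 'a \<Rightarrow> 'a) \<Rightarrow> ('b, 'd) monoid_scheme \<Rightarrow> ('a \<times> 'b) monoid"
  where "semidirect_product H \<mu> G =
    \<lparr>carrier = carrier H \<times> carrier G,
     monoid.mult = (\<lambda>(h, g) (h', g'). (h \<otimes>\<^bsub>H\<^esub> \<mu> g h', g \<otimes>\<^bsub>G\<^esub> g')),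
     one = (\<one>\<^bsub>H\<^esub>, \<one>\<^bsub>G\<^esub>)\<rparr>"

lemma group_semidirect_product:
  assumes "group H" "group G" and mu: "\<mu> \<in> hom G (AutoGroup H)"
  shows "group (semidirect_product H \<mu> G)"
proof -
  interpret H: group H by fact
  interpret G: group G by fact
  interpret A: group "AutoGroup H" by (rule H.AutoGroup)
  interpret mu: group_hom G "AutoGroup H" \<mu>
    using mu by unfold_locales
  note [simp del] = mu.hom_inv mu.hom_mult mu.hom_one
  have aut: "\<mu> g \<in> auto H" if "g \<in> carrier G" for g
    using mu.hom_closed[OF that] by (simp add: AutoGroup_def)
  have closed: "\<mu> g h \<in> carrier H" if "g \<in> carrier G" "h \<in> carrier H" for g h
    using aut[OF that(1)] that(2) by (auto simp: auto_def hom_def)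
  have hom: "\<mu> g (h \<otimes>\<^bsub>H\<^esub> h') = \<mu> g h \<otimes>\<^bsub>H\<^esub> \<mu> g h'"
    if "g \<in> carrier G" "h \<in> carrier H" "h' \<in> carrier H" for g h h'
    using aut[OF that(1)] that by (auto simp: auto_def hom_def)
  have comp: "\<mu> (g \<otimes>\<^bsub>G\<^esub> g') h = \<mu> g (\<mu> g' h)"
    if "g \<in> carrier G" "g' \<in> carrier G" "h \<in> carrier H" for g g' h
    using mu.hom_mult[OF that(1,2)] aut[OF that(1)] aut[OF that(2)] that
    by (simp add: AutoGroup_def BijGroup_def auto_def compose_def)
  have one: "\<mu> \<one>\<^bsub>G\<^esub> h = h" if "h \<in> carrier H" for h
    using mu.hom_one that by (simp add: AutoGroup_def BijGroup_def)
  show ?thesis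
  proof (rule groupI)
    fix x assume "x \<in> carrier (semidirect_product H \<mu> G)"
    then obtain h g where x: "x = (h, g)" "h \<in> carrier H" "g \<in> carrier G"
      by (auto simp: semidirect_product_def)
    define y where "y = (\<mu> (inv\<^bsub>G\<^esub> g) (inv\<^bsub>H\<^esub> h), inv\<^bsub>G\<^esub> g)"
    have "\<mu> (inv\<^bsub>G\<^esub> g) (inv\<^bsub>H\<^esub> h) \<otimes>\<^bsub>H\<^esub> \<mu> (inv\<^bsub>G\<^esub> g) h = \<mu> (inv\<^bsub>G\<^esub> g) \<one>\<^bsub>H\<^esub>"
      using x by (simp flip: hom)
    also have "\<dots> = \<one>\<^bsub>H\<^esub>"
      using hom[of "inv\<^bsub>G\<^esub> g" "\<one>\<^bsub>H\<^esub>" "\<one>\<^bsub>H\<^esub>"] closed[of "inv\<^bsub>G\<^esub> g" "\<one>\<^bsub>H\<^esub>"] x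
      by (simp add: H.l_cancel_one)
    finally have "y \<otimes>\<^bsub>semidirect_product H \<mu> G\<^esub> x = \<one>\<^bsub>semidirect_product H \<mu> G\<^esub>"
      using x by (simp add: y_def semidirect_product_def)
    moreover have "y \<in> carrier (semidirect_product H \<mu> G)"
      using x by (auto simp: y_def semidirect_product_def closed)
    ultimately show "\<exists>y\<in>carrier (semidirect_product H \<mu> G).
        y \<otimes>\<^bsub>semidirect_product H \<mu> G\<^esub> x = \<one>\<^bsub>semidirect_product H \<mu> G\<^esub>"
      by blast
  qed (auto simp: semidirect_product_def closed hom comp one H.m_assoc G.m_assoc)
qed

text \<open>
  The class of A'-groups is defined up to isomorphism, and an inductive predicate lives on a
  single type. The rules are therefore stated for groups with carrier in \<^typ>\<open>nat\<close>, where every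
  finite group has an isomorphic copy; the predicate \<open>A'_group\<close> below carries the class over to
  arbitrary carrier types. An action by automorphisms is a homomorphism into \<^const>\<open>AutoGroup\<close>.
\<close>

inductive A'_group_nat :: "nat monoid \<Rightarrow> bool" where
  abelian: "\<lbrakk>comm_group K; finite (carrier K)\<rbrakk> \<Longrightarrow> A'_group_nat K"
| semidirect: "\<lbrakk>A'_group_nat G; comm_group (H :: nat monoid); finite (carrier H); coprime (order H) (order G);
    \<mu> \<in> hom G (AutoGroup H); group K; K \<cong> semidirect_product H \<mu> G\<rbrakk> \<Longrightarrow> A'_group_nat K"
| direct: "\<lbrakk>A'_group_nat G1; A'_group_nat G2; group K; K \<cong> G1 \<times>\<times> G2\<rbrakk> \<Longrightarrow> A'_group_nat K"

definition A'_group :: "('a, 'b) monoid_scheme \<Rightarrow> bool"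
  where "A'_group G \<longleftrightarrow> group G \<and> (\<exists>K. A'_group_nat K \<and> G \<cong> K)"

lemma A'_group_natD: "A'_group_nat K \<Longrightarrow> group K \<and> finite (carrier K)"
proof (induction rule: A'_group_nat.induct)
  case (abelian K)
  then show ?case by (simp add: comm_group_def)
next
  case (semidirect G H \<mu> K)
  then show ?case
    by (auto simp: is_iso_def iso_def semidirect_product_def dest: bij_betw_finite)
next
  case (direct G1 G2 K)
  then show ?case
    by (auto simp: is_iso_def iso_def dest: bij_betw_finite)
qed

end

theory Submission
  imports Defs
begin

text \<open>
  By Sylow's theorem, an \<open>A\<close>-group whose order has no prime divisors besides \<open>p\<close> and \<open>q\<close> is a
  product \<open>G = P Q\<close> of two abelian subgroups of coprime orders. Nothing else about \<open>G\<close> is used: every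
  such product is an \<open>A'\<close>-group, because it is the direct product of \<open>R N\<^sub>P(Q)\<close> and \<open>S N\<^sub>Q(P)\<close> for suitable
  normal subgroups \<open>R \<subseteq> Q\<close> and \<open>S \<subseteq> P\<close> (\<open>direct_decomposition\<close>), and each of these two factors is a
  semidirect product of abelian groups of coprime orders.

  The argument is elementary and does not need solvability of groups of order \<open>p\<^sup>a q\<^sup>b\<close>. Let \<open>K\<close> be
  generated by the commutators of elements of \<open>P\<close> with elements of \<open>Q\<close>. It is normal, and
  Ito's commutator calculation shows that it is abelian (\<open>commutators_commute\<close>). So \<open>K = R S\<close>, where
  \<open>R\<close> and \<open>S\<close> consist of the elements of \<open>K\<close> of order dividing \<open>|Q|\<close> and \<open>|P|\<close>; both are
  normal in \<open>G\<close>, and they turn out to be \<open>K \<inter> Q\<close> and \<open>K \<inter> P\<close>. Two facts give the complement of \<open>R\<close>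
  in \<open>Q\<close>:

  \<^item> \<open>Q = R N\<^sub>Q(P)\<close>. Each \<open>y \<in> Q\<close> maps \<open>P\<close> into \<open>R P\<close> under conjugation, and since \<open>|R|\<close> and \<open>|P|\<close> are
    coprime, averaging a cocycle over \<open>P\<close> yields \<open>t \<in> R\<close> such that \<open>t y\<close> normalises \<open>P\<close>
    (\<open>coprime_complement_normalizer\<close>, a Frattini argument).

  \<^item> \<open>R \<inter> N\<^sub>Q(P) = 1\<close>. An element \<open>c\<close> of the intersection commutes with \<open>P\<close>, so the transfer
    homomorphism \<open>G \<rightarrow> Q\<close> sends it to \<open>c\<close> raised to the power \<open>|P|\<close>. But the transfer kills \<open>K\<close>, whence
    \<open>c = 1\<close> (\<open>CommQ_central_trivial\<close>).

  By symmetry \<open>S\<close> has the complement \<open>N\<^sub>P(Q)\<close> in \<open>P\<close>. The subgroups \<open>N\<^sub>Q(P)\<close> and \<open>N\<^sub>P(Q)\<close> commute with each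
  other, as their commutators lie in \<open>P \<inter> Q = 1\<close>, and the other commutation relations needed hold
  because \<open>P\<close>, \<open>Q\<close> and \<open>K\<close> are abelian.

  The class of \<open>A'\<close>-groups is generated within the type of natural numbers, so the
  factorization is carried over to an isomorphic copy of \<open>G\<close> there, in which all the subgroups
  above are available as groups of the right type.
\<close>

section \<open>Preliminaries on groups\<close>

context group
begin

lemma inv_mult_cancel:
  assumes "x \<in> carrier G" "y \<in> carrier G"
  shows "inv x \<otimes> (x \<otimes> y) = y" "x \<otimes> (inv x \<otimes> y) = y"
  using assms by (simp_all flip: m_assoc)

text \<open>
  As rewrite rules these bring group words into freely reduced form.
\<close>

lemmas group_word_simps = m_assoc inv_mult_group inv_mult_cancel

lemma conj_pow:
  assumes "g \<in> carrier G" "h \<in> carrier G"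
  shows "(g \<otimes> h \<otimes> inv g) [^] (n :: nat) = g \<otimes> h [^] n \<otimes> inv g"
  using assms by (induction n) (simp_all add: group_word_simps)

lemma coprime_pow_eq_one:
  assumes "x \<in> carrier G" "x [^] (a :: nat) = \<one>" "x [^] (b :: nat) = \<one>" "coprime a b"
  shows "x = \<one>"
  using assms by (metis coprime_common_divisor_nat ord_eq_1 pow_eq_id)

lemma pow_card_subgroup:
  assumes "subgroup H G" "x \<in> H"
  shows "x [^] card H = \<one>"
  using group.pow_order_eq_1[OF subgroup_imp_group[OF assms(1)], of x] assms(2)
  by (simp add: order_def flip: nat_pow_consistent)

lemma coprime_card_Int:
  assumes "subgroup H G" "subgroup K G" "coprime (card H) (card K)" "x \<in> H" "x \<in> K"
  shows "x = \<one>"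
  by (rule coprime_pow_eq_one[OF _ pow_card_subgroup[OF assms(1,4)]
        pow_card_subgroup[OF assms(2,5)] assms(3)])
    (use assms subgroup.mem_carrier in metis)

lemma subgroup_comm_groupI:
  assumes "subgroup H G" "\<And>x y. x \<in> H \<Longrightarrow> y \<in> H \<Longrightarrow> x \<otimes> y = y \<otimes> x"
  shows "comm_group (G\<lparr>carrier := H\<rparr>)"
  using group.group_comm_groupI[OF subgroup_imp_group[OF assms(1)]] assms(2) by simp

lemma commuting_subgroup:
  assumes "z \<in> carrier G"
  shows "subgroup {g \<in> carrier G. g \<otimes> z = z \<otimes> g} G"
proof (rule subgroupI)
  fix a assume "a \<in> {g \<in> carrier G. g \<otimes> z = z \<otimes> g}"
  then have a: "a \<in> carrier G" "a \<otimes> z = z \<otimes> a" by auto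
  have "inv a \<otimes> z = inv a \<otimes> (z \<otimes> a) \<otimes> inv a"
    using a(1) assms by (simp add: group_word_simps)
  also have "\<dots> = z \<otimes> inv a"
    unfolding a(2)[symmetric] using a(1) assms by (simp add: group_word_simps)
  finally show "inv a \<in> {g \<in> carrier G. g \<otimes> z = z \<otimes> g}"
    using a by simp
next
  fix a b assume "a \<in> {g \<in> carrier G. g \<otimes> z = z \<otimes> g}" "b \<in> {g \<in> carrier G. g \<otimes> z = z \<otimes> g}"
  then show "a \<otimes> b \<in> {g \<in> carrier G. g \<otimes> z = z \<otimes> g}"
    using assms by (simp add: m_assoc) (simp flip: m_assoc)
qed (use assms in auto)

lemma generate_commute:
  assumes D: "D \<subseteq> carrier G" and comm: "\<And>x y. x \<in> D \<Longrightarrow> y \<in> D \<Longrightarrow> x \<otimes> y = y \<otimes> x"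
    and "x \<in> generate G D" "y \<in> generate G D"
  shows "x \<otimes> y = y \<otimes> x"
proof -
  have "generate G D \<subseteq> {g \<in> carrier G. g \<otimes> z = z \<otimes> g}" if "z \<in> D" for z
    using that D comm by (intro generate_subgroup_incl commuting_subgroup) auto
  then have *: "x \<otimes> z = z \<otimes> x" if "z \<in> D" for z
    using that assms(3) by auto
  have "generate G D \<subseteq> {g \<in> carrier G. g \<otimes> x = x \<otimes> g}"
    using generate_in_carrier[OF D assms(3)] D *
    by (intro generate_subgroup_incl commuting_subgroup) (auto simp: eq_commute)
  then show ?thesis
    using assms(4) by auto
qed

lemma subgroup_conj_vimage:
  assumes "subgroup N G" "g \<in> carrier G"
  shows "subgroup {h \<in> carrier G. g \<otimes> h \<otimes> inv g \<in> N} G"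
proof (rule subgroupI)
  interpret N: subgroup N G by fact
  show "{h \<in> carrier G. g \<otimes> h \<otimes> inv g \<in> N} \<noteq> {}"
    using assms by (auto intro!: exI[of _ \<one>])
  fix a b assume ab: "a \<in> {h \<in> carrier G. g \<otimes> h \<otimes> inv g \<in> N}" "b \<in> {h \<in> carrier G. g \<otimes> h \<otimes> inv g \<in> N}"
  have "(g \<otimes> a \<otimes> inv g) \<otimes> (g \<otimes> b \<otimes> inv g) = g \<otimes> (a \<otimes> b) \<otimes> inv g"
    using ab assms by (simp add: group_word_simps)
  then show "a \<otimes> b \<in> {h \<in> carrier G. g \<otimes> h \<otimes> inv g \<in> N}"
    using ab N.m_closed[of "g \<otimes> a \<otimes> inv g" "g \<otimes> b \<otimes> inv g"] by auto
next
  interpret N: subgroup N G by fact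
  fix a assume a: "a \<in> {h \<in> carrier G. g \<otimes> h \<otimes> inv g \<in> N}"
  have "inv (g \<otimes> a \<otimes> inv g) = g \<otimes> inv a \<otimes> inv g"
    using a assms by (simp add: group_word_simps)
  then show "inv a \<in> {h \<in> carrier G. g \<otimes> h \<otimes> inv g \<in> N}"
    using a N.m_inv_closed[of "g \<otimes> a \<otimes> inv g"] by auto
qed auto

lemma generate_conj_closed:
  assumes D: "D \<subseteq> carrier G" and g: "g \<in> carrier G"
    and "\<And>d. d \<in> D \<Longrightarrow> g \<otimes> d \<otimes> inv g \<in> generate G D" "k \<in> generate G D"
  shows "g \<otimes> k \<otimes> inv g \<in> generate G D"
proof -
  have "generate G D \<subseteq> {h \<in> carrier G. g \<otimes> h \<otimes> inv g \<in> generate G D}"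
    using assms by (intro generate_subgroup_incl subgroup_conj_vimage generate_is_subgroup) auto
  then show ?thesis
    using assms(4) by blast
qed

lemma commute_iff_conj:
  assumes "x \<in> carrier G" "y \<in> carrier G"
  shows "x \<otimes> y = y \<otimes> x \<longleftrightarrow> x \<otimes> y \<otimes> inv x = y"
proof
  assume "x \<otimes> y \<otimes> inv x = y"
  then have "x \<otimes> y \<otimes> inv x \<otimes> x = y \<otimes> x" by simp
  then show "x \<otimes> y = y \<otimes> x" using assms by (simp add: group_word_simps)
qed (use assms in \<open>simp add: group_word_simps\<close>)

lemma finprod_conj:
  assumes "subgroup N G" "comm_group (G\<lparr>carrier := N\<rparr>)" "g \<in> carrier G"
    and "\<And>h. h \<in> N \<Longrightarrow> g \<otimes> h \<otimes> inv g \<in> N" "f \<in> A \<rightarrow> N"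
  shows "g \<otimes> finprod (G\<lparr>carrier := N\<rparr>) f A \<otimes> inv g
    = finprod (G\<lparr>carrier := N\<rparr>) (\<lambda>x. g \<otimes> f x \<otimes> inv g) A"
proof -
  interpret N: subgroup N G by fact
  interpret NG: comm_group "G\<lparr>carrier := N\<rparr>" by fact
  show ?thesis
    using assms(5)
  proof (induction A rule: infinite_finite_induct)
    case (insert x A)
    then have "finprod (G\<lparr>carrier := N\<rparr>) f A \<in> N"
      using NG.finprod_closed[of f A] by auto
    moreover have "finprod (G\<lparr>carrier := N\<rparr>) f (insert x A) = f x \<otimes> finprod (G\<lparr>carrier := N\<rparr>) f A"
      using insert NG.finprod_insert[of A x f] by auto
    moreover have "finprod (G\<lparr>carrier := N\<rparr>) (\<lambda>x. g \<otimes> f x \<otimes> inv g) (insert x A)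
        = (g \<otimes> f x \<otimes> inv g) \<otimes> finprod (G\<lparr>carrier := N\<rparr>) (\<lambda>x. g \<otimes> f x \<otimes> inv g) A"
      using insert assms(4) NG.finprod_insert[of A x "\<lambda>x. g \<otimes> f x \<otimes> inv g"] by (auto simp: Pi_iff)
    moreover have "f x \<in> N" using insert by auto
    ultimately show ?case
      using insert assms(3) by (simp add: group_word_simps flip: insert.IH)
  qed (use assms in auto)
qed

text \<open>
  Let \<open>N\<close> be an abelian normal subgroup whose exponent is prime to \<open>|P|\<close>. An element \<open>y\<close> that
  conjugates \<open>P\<close> into \<open>N P\<close> can be corrected by an element of \<open>N\<close> so as to conjugate \<open>P\<close> into itself.
  This is the vanishing of the first cohomology of \<open>P\<close> with coefficients in \<open>N\<close>: writing
  \<open>y z y\<^sup>-\<^sup>1 = r(z) p(z)\<close>, the \<open>N\<close>-part \<open>r\<close> is a cocycle, and the product of its values over \<open>P\<close> exhibits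
  it as a coboundary.
\<close>

lemma coprime_complement_normalizer:
  assumes subP: "subgroup P G" and finP: "finite P"
    and normal: "N \<lhd> G" and comm: "\<And>x y. x \<in> N \<Longrightarrow> y \<in> N \<Longrightarrow> x \<otimes> y = y \<otimes> x"
    and exponent: "\<And>x. x \<in> N \<Longrightarrow> x [^] n = \<one>" and coprime: "coprime (card P) n"
    and y: "y \<in> carrier G"
    and conj: "\<And>z. z \<in> P \<Longrightarrow> \<exists>r\<in>N. \<exists>p\<in>P. y \<otimes> z \<otimes> inv y = r \<otimes> p"
  shows "\<exists>t\<in>N. \<forall>z\<in>P. (t \<otimes> y) \<otimes> z \<otimes> inv (t \<otimes> y) \<in> P"
proof -
  interpret P: subgroup P G by fact
  interpret N: normal N G by fact
  note subN = N.subgroup_axioms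
  let ?N = "G\<lparr>carrier := N\<rparr>"
  interpret NG: comm_group ?N
    by (rule subgroup_comm_groupI[OF subN comm])
  define m where "m = card P"
  have "m \<noteq> 0" using finP P.one_closed unfolding m_def by (metis card_0_eq empty_iff)
  then obtain u v where uv: "m * u = n * v + 1"
    using coprime bezout_nat[of m n] by (auto simp: m_def coprime_iff_gcd_eq_1)
  \<comment> \<open>Raising to the power \<open>u\<close> inverts \<open>m\<close>-th powers in \<open>N\<close>.\<close>
  have pow_uv: "x [^] (m * u) = x" if "x \<in> N" for x
    using that exponent[OF that] by (simp add: uv flip: nat_pow_pow nat_pow_mult)
  have conjN: "g \<otimes> x \<otimes> inv g \<in> N" if "g \<in> carrier G" "x \<in> N" for g x
    using that by (rule N.inv_op_closed2)
  have Int: "x = \<one>" if "x \<in> P" "x \<in> N" for x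
    using coprime_pow_eq_one[OF _ pow_card_subgroup[OF subP that(1)] exponent[OF that(2)] coprime] that
    by simp
  obtain r p where rp: "\<And>z. z \<in> P \<Longrightarrow> r z \<in> N" "\<And>z. z \<in> P \<Longrightarrow> p z \<in> P"
    "\<And>z. z \<in> P \<Longrightarrow> y \<otimes> z \<otimes> inv y = r z \<otimes> p z"
    using conj by metis
  have cocycle: "r (z \<otimes> w) = r z \<otimes> (p z \<otimes> r w \<otimes> inv (p z))" if "z \<in> P" "w \<in> P" for z w
  proof -
    have "r (z \<otimes> w) \<otimes> p (z \<otimes> w) = (y \<otimes> z \<otimes> inv y) \<otimes> (y \<otimes> w \<otimes> inv y)"
      using that rp(3)[of "z \<otimes> w"] y by (simp add: group_word_simps)
    also have "\<dots> = r z \<otimes> (p z \<otimes> r w \<otimes> inv (p z)) \<otimes> (p z \<otimes> p w)"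
      using that rp(1,2) by (simp add: rp(3) group_word_simps)
    finally have *: "r (z \<otimes> w) \<otimes> p (z \<otimes> w) = r z \<otimes> (p z \<otimes> r w \<otimes> inv (p z)) \<otimes> (p z \<otimes> p w)" .
    define a where "a = r z \<otimes> (p z \<otimes> r w \<otimes> inv (p z))"
    have a: "a \<in> N" unfolding a_def using that rp conjN by simp
    have "inv a \<otimes> r (z \<otimes> w) = inv a \<otimes> (r (z \<otimes> w) \<otimes> p (z \<otimes> w)) \<otimes> inv (p (z \<otimes> w))"
      using that rp(1,2) a by (simp add: group_word_simps)
    also have "\<dots> = p z \<otimes> p w \<otimes> inv (p (z \<otimes> w))"
      unfolding * a_def[symmetric] using that rp(1,2) a by (simp add: group_word_simps)
    finally have "inv a \<otimes> r (z \<otimes> w) \<in> P" using that rp(2) by simp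
    then have "inv a \<otimes> r (z \<otimes> w) = \<one>"
      using that rp(1) a by (intro Int) auto
    then show ?thesis
      unfolding a_def[symmetric] using that rp(1) a
      by (metis N.mem_carrier P.m_closed inv_closed inv_equality inv_inv inv_comm)
  qed
  \<comment> \<open>Multiplying the cocycle identity over all \<open>w \<in> P\<close> shows that \<open>r(z)\<^sup>m\<close> is the coboundary of \<open>T\<close>.\<close>
  define T where "T = finprod ?N r P"
  have T: "T \<in> N" unfolding T_def using NG.finprod_closed[of r P] rp(1) by auto
  have T_eq: "T = r z [^] m \<otimes> (p z \<otimes> T \<otimes> inv (p z))" if z: "z \<in> P" for z
  proof -
    have inj: "inj_on (\<lambda>w. z \<otimes> w) P"
      using z by (intro inj_onI) simp
    have img: "(\<lambda>w. z \<otimes> w) ` P = P"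
      using z inj finP by (intro endo_inj_surj) auto
    have "T = finprod ?N (\<lambda>w. r (z \<otimes> w)) P"
      using NG.finprod_reindex[of r "\<lambda>w. z \<otimes> w" P] inj img rp(1) by (auto simp: T_def)
    also have "\<dots> = finprod ?N (\<lambda>w. r z \<otimes>\<^bsub>?N\<^esub> (p z \<otimes> r w \<otimes> inv (p z))) P"
      using z rp conjN by (intro NG.finprod_cong') (auto simp: cocycle)
    also have "\<dots> = finprod ?N (\<lambda>w. r z) P \<otimes>\<^bsub>?N\<^esub> finprod ?N (\<lambda>w. p z \<otimes> r w \<otimes> inv (p z)) P"
      using z rp conjN by (intro NG.finprod_multf) auto
    also have "finprod ?N (\<lambda>w. r z) P = r z [^] m"
      using z rp NG.finprod_const[of "r z" P] by (simp add: m_def flip: nat_pow_consistent)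
    also have "finprod ?N (\<lambda>w. p z \<otimes> r w \<otimes> inv (p z)) P = p z \<otimes> T \<otimes> inv (p z)"
      unfolding T_def using z rp conjN NG.comm_group_axioms subN by (subst finprod_conj) auto
    finally show ?thesis by simp
  qed
  \<comment> \<open>So \<open>r\<close> itself is the coboundary of the \<open>m\<close>-th root \<open>t\<close> of the inverse of \<open>T\<close>.\<close>
  define t where "t = inv T [^] u"
  have pow_closed: "x [^] (k :: nat) \<in> N" if "x \<in> N" for x k
    using that by (induction k) auto
  have t: "t \<in> N" unfolding t_def using T pow_closed by simp
  have t_pow: "t [^] m = inv T"
    unfolding t_def using T pow_uv[of "inv T"] by (simp add: nat_pow_pow mult.commute)
  have t_eq: "t \<otimes> r z = p z \<otimes> t \<otimes> inv (p z)" if z: "z \<in> P" for z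
  proof -
    define a where "a = p z \<otimes> T \<otimes> inv (p z)"
    have a: "a \<in> N" unfolding a_def using z rp T conjN by simp
    have "(t \<otimes> r z) [^] m = inv T \<otimes> r z [^] m"
      using pow_mult_distrib[of t "r z" m] comm z rp(1) t t_pow by simp
    also have "\<dots> = inv (r z [^] m \<otimes> a) \<otimes> r z [^] m"
      using T_eq[OF z] unfolding a_def by simp
    also have "\<dots> = inv a"
      using z rp(1) a by (simp add: group_word_simps)
    also have "\<dots> = (p z \<otimes> t \<otimes> inv (p z)) [^] m"
      unfolding a_def using z rp(2) t T
      by (simp only: conj_pow P.mem_carrier N.mem_carrier t_pow) (simp add: group_word_simps)
    finally have "((t \<otimes> r z) [^] m) [^] u = ((p z \<otimes> t \<otimes> inv (p z)) [^] m) [^] u"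
      by simp
    then show ?thesis
      using pow_uv[of "t \<otimes> r z"] pow_uv[of "p z \<otimes> t \<otimes> inv (p z)"] z rp t conjN
      by (simp add: nat_pow_pow)
  qed
  have "(t \<otimes> y) \<otimes> z \<otimes> inv (t \<otimes> y) \<in> P" if z: "z \<in> P" for z
  proof -
    have "(t \<otimes> y) \<otimes> z \<otimes> inv (t \<otimes> y) = t \<otimes> (y \<otimes> z \<otimes> inv y) \<otimes> inv t"
      using z y t by (simp add: group_word_simps)
    also have "\<dots> = (t \<otimes> r z) \<otimes> p z \<otimes> inv t"
      using z rp(1,2) t by (simp add: rp(3) group_word_simps)
    also have "\<dots> = p z"
      using z rp(2) t by (simp add: t_eq group_word_simps)
    finally show ?thesis using z rp(2) by simp
  qed
  then show ?thesis using t by blast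
qed

lemma card_subgroup_dvd:
  assumes "subgroup H G" "subgroup K G" "H \<subseteq> K"
  shows "card H dvd card K"
proof -
  have "card H dvd order (G\<lparr>carrier := K\<rparr>)"
    unfolding group.lagrange[OF subgroup_imp_group[OF assms(2)] subgroup_incl[OF assms], symmetric]
    by (rule dvd_triv_right)
  then show ?thesis by (simp add: order_def)
qed

end

section \<open>Products of two abelian subgroups of coprime orders\<close>

text \<open>
  The assumptions are symmetric in \<open>P\<close> and \<open>Q\<close> (lemma \<open>swap\<close>). Below, each construction is made for \<open>Q\<close>
  only; its counterpart for \<open>P\<close> comes from interpreting the locale with \<open>P\<close> and \<open>Q\<close> exchanged.
\<close>

locale abelian_factorization = group G for G (structure) +
  fixes P Q :: "'a set"
  assumes finite_G: "finite (carrier G)"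
    and subP: "subgroup P G" and subQ: "subgroup Q G"
    and commP: "\<And>x y. x \<in> P \<Longrightarrow> y \<in> P \<Longrightarrow> x \<otimes> y = y \<otimes> x"
    and commQ: "\<And>x y. x \<in> Q \<Longrightarrow> y \<in> Q \<Longrightarrow> x \<otimes> y = y \<otimes> x"
    and factor: "\<And>g. g \<in> carrier G \<Longrightarrow> \<exists>x\<in>P. \<exists>y\<in>Q. g = x \<otimes> y"
    and coprime_PQ: "coprime (card P) (card Q)"
begin

sublocale P: subgroup P G by (rule subP)
sublocale Q: subgroup Q G by (rule subQ)

lemma factor_swap: "g \<in> carrier G \<Longrightarrow> \<exists>y\<in>Q. \<exists>x\<in>P. g = y \<otimes> x"
proof -
  assume g: "g \<in> carrier G"
  then obtain x y where xy: "x \<in> P" "y \<in> Q" "inv g = x \<otimes> y"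
    using factor[of "inv g"] by auto
  then have "g = inv y \<otimes> inv x"
    using g by (metis P.mem_carrier Q.mem_carrier inv_inv inv_mult_group)
  then show ?thesis using xy by blast
qed

lemma swap: "abelian_factorization G Q P"
  using finite_G subP subQ commP commQ factor_swap coprime_PQ
  by unfold_locales (auto simp: coprime_commute)

lemma Int_PQ: "x \<in> P \<Longrightarrow> x \<in> Q \<Longrightarrow> x = \<one>"
  by (rule coprime_card_Int[OF subP subQ coprime_PQ])

lemma finite_P: "finite P" and finite_Q: "finite Q"
  using finite_G P.subset Q.subset finite_subset by blast+

lemma card_P_pos: "card P > 0"
  using finite_P P.one_closed card_gt_0_iff by blast

lemma factor_unique:
  assumes "x \<in> P" "y \<in> Q" "x' \<in> P" "y' \<in> Q" "x \<otimes> y = x' \<otimes> y'"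
  shows "x = x' \<and> y = y'"
proof -
  have "inv x' \<otimes> x = inv x' \<otimes> (x \<otimes> y) \<otimes> inv y"
    using assms(1-4) by (simp add: group_word_simps)
  also have "\<dots> = y' \<otimes> inv y"
    unfolding assms(5) using assms(1-4) by (simp add: group_word_simps)
  finally have *: "inv x' \<otimes> x = y' \<otimes> inv y" .
  have "inv x' \<otimes> x \<in> P" "y' \<otimes> inv y \<in> Q" using assms by auto
  then have "inv x' \<otimes> x = \<one>" "y' \<otimes> inv y = \<one>"
    using * Int_PQ by auto
  then show ?thesis
    using assms by (metis P.mem_carrier Q.mem_carrier inv_closed inv_equality inv_inv)
qed

lemma card_mult: "order G = card P * card Q"
proof -
  have "bij_betw (\<lambda>(x, y). x \<otimes> y) (P \<times> Q) (carrier G)"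
    unfolding bij_betw_def inj_on_def using factor_unique factor by (auto simp: image_iff)
  then show ?thesis
    by (simp add: order_def flip: bij_betw_same_card card_cartesian_product)
qed

text \<open>
  The subgroup \<open>Comm\<close> generated by the mixed commutators is in fact the derived subgroup of \<open>G\<close>; what
  matters is that it is normal and abelian, and that \<open>P\<close> and \<open>Q\<close> commute modulo it.
\<close>

definition commutators :: "'a set"
  where "commutators = {x \<otimes> y \<otimes> inv x \<otimes> inv y | x y. x \<in> P \<and> y \<in> Q}"

definition Comm :: "'a set"
  where "Comm = generate G commutators"

lemma commutators_carrier: "commutators \<subseteq> carrier G"
  by (auto simp: commutators_def)

lemma commutators_Comm: "x \<in> P \<Longrightarrow> y \<in> Q \<Longrightarrow> x \<otimes> y \<otimes> inv x \<otimes> inv y \<in> Comm"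
  unfolding Comm_def by (rule generate.incl) (auto simp: commutators_def)

lemma subgroup_Comm: "subgroup Comm G"
  unfolding Comm_def by (rule generate_is_subgroup[OF commutators_carrier])

sublocale Comm: subgroup Comm G by (rule subgroup_Comm)

lemma Comm_conj:
  assumes "g \<in> carrier G" "k \<in> Comm"
  shows "g \<otimes> k \<otimes> inv g \<in> Comm"
proof -
  have conjP: "x \<otimes> k \<otimes> inv x \<in> Comm" if "x \<in> P" "k \<in> Comm" for x k
    unfolding Comm_def
  proof (rule generate_conj_closed[OF commutators_carrier])
    fix d assume "d \<in> commutators"
    then obtain x' y where d: "x' \<in> P" "y \<in> Q" "d = x' \<otimes> y \<otimes> inv x' \<otimes> inv y"
      by (auto simp: commutators_def)
    \<comment> \<open>With \<open>[x, y] = x y x\<^sup>-\<^sup>1 y\<^sup>-\<^sup>1\<close>, conjugating \<open>[x', y]\<close> by \<open>x\<close> gives \<open>[x x', y] [x, y]\<^sup>-\<^sup>1\<close>.\<close>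
    have "x \<otimes> d \<otimes> inv x
        = (x \<otimes> x' \<otimes> y \<otimes> inv (x \<otimes> x') \<otimes> inv y) \<otimes> inv (x \<otimes> y \<otimes> inv x \<otimes> inv y)"
      using d that by (simp add: group_word_simps)
    also have "\<dots> \<in> Comm"
      using d that by (intro Comm.m_closed Comm.m_inv_closed commutators_Comm) auto
    finally show "x \<otimes> d \<otimes> inv x \<in> generate G commutators" by (simp add: Comm_def)
  qed (use that Comm_def in auto)
  have conjQ: "y \<otimes> k \<otimes> inv y \<in> Comm" if "y \<in> Q" "k \<in> Comm" for y k
    unfolding Comm_def
  proof (rule generate_conj_closed[OF commutators_carrier])
    fix d assume "d \<in> commutators"
    then obtain x y' where d: "x \<in> P" "y' \<in> Q" "d = x \<otimes> y' \<otimes> inv x \<otimes> inv y'"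
      by (auto simp: commutators_def)
    have "y \<otimes> d \<otimes> inv y
        = inv (x \<otimes> y \<otimes> inv x \<otimes> inv y) \<otimes> (x \<otimes> (y \<otimes> y') \<otimes> inv x \<otimes> inv (y \<otimes> y'))"
      using d that commQ[of "inv y'" "inv y"] by (simp add: group_word_simps)
    also have "\<dots> \<in> Comm"
      using d that by (intro Comm.m_closed Comm.m_inv_closed commutators_Comm) auto
    finally show "y \<otimes> d \<otimes> inv y \<in> generate G commutators" by (simp add: Comm_def)
  qed (use that Comm_def in auto)
  obtain x y where xy: "x \<in> P" "y \<in> Q" "g = x \<otimes> y"
    using factor assms(1) by blast
  have "g \<otimes> k \<otimes> inv g = x \<otimes> (y \<otimes> k \<otimes> inv y) \<otimes> inv x"
    using xy assms by (simp add: group_word_simps)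
  then show ?thesis
    using conjP conjQ xy assms by simp
qed

text \<open>
  This is the key step of Ito's theorem that a product of two abelian groups is metabelian. Conjugating
  \<open>c = [a, b]\<close> by \<open>x \<in> P\<close> and \<open>y \<in> Q\<close> gives the same result in either order. Conjugation by \<open>x\<close> fixes
  \<open>a\<close> and turns \<open>b\<close> into some \<open>b2 a2\<close>, whose factor \<open>a2 \<in> P\<close> has no effect in the commutator with
  \<open>a\<close>; likewise \<open>y\<close> fixes \<open>b\<close> and turns \<open>a\<close> into some \<open>a3 b3\<close>. Both orders therefore lead to \<open>[a3, b2]\<close>.
\<close>

lemma commutators_commute:
  assumes "c \<in> commutators" "d \<in> commutators"
  shows "d \<otimes> c = c \<otimes> d"
proof -
  obtain a b where c: "a \<in> P" "b \<in> Q" "c = a \<otimes> b \<otimes> inv a \<otimes> inv b"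
    using assms(1) by (auto simp: commutators_def)
  obtain x0 y0 where "x0 \<in> P" "y0 \<in> Q" "d = x0 \<otimes> y0 \<otimes> inv x0 \<otimes> inv y0"
    using assms(2) by (auto simp: commutators_def)
  \<comment> \<open>Inverting both entries turns \<open>d\<close> into \<open>(y x)\<^sup>-\<^sup>1 (x y)\<close>.\<close>
  then obtain x y where d: "x \<in> P" "y \<in> Q" "d = inv x \<otimes> inv y \<otimes> x \<otimes> y"
    by (metis P.m_inv_closed P.mem_carrier Q.m_inv_closed Q.mem_carrier inv_inv)
  obtain b2 a2 where 1: "b2 \<in> Q" "a2 \<in> P" "x \<otimes> b \<otimes> inv x = b2 \<otimes> a2"
    using factor_swap[of "x \<otimes> b \<otimes> inv x"] c d by auto
  obtain a3 b3 where 2: "a3 \<in> P" "b3 \<in> Q" "y \<otimes> a \<otimes> inv y = a3 \<otimes> b3"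
    using factor[of "y \<otimes> a \<otimes> inv y"] c d by auto
  have eq1: "a \<otimes> (b2 \<otimes> a2) \<otimes> inv a \<otimes> inv (b2 \<otimes> a2) = a \<otimes> b2 \<otimes> inv a \<otimes> inv b2"
    if "a \<in> P" for a
  proof -
    have "a2 \<otimes> (inv a \<otimes> inv a2) = inv a"
      using commP[of a2 "inv a"] commute_iff_conj[of a2 "inv a"] that 1 by (simp add: m_assoc)
    then show ?thesis
      using that 1 by (simp add: group_word_simps) (simp flip: m_assoc)
  qed
  have eq2: "a3 \<otimes> b3 \<otimes> b \<otimes> inv (a3 \<otimes> b3) \<otimes> inv b = a3 \<otimes> b \<otimes> inv a3 \<otimes> inv b"
    if "b \<in> Q" for b
  proof -
    have "b3 \<otimes> (b \<otimes> inv b3) = b"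
      using commQ[of b3 b] commute_iff_conj[of b3 b] that 2 by (simp add: m_assoc)
    then show ?thesis
      using that 2 by (simp add: group_word_simps) (simp flip: m_assoc)
  qed
  have cx: "x \<otimes> c \<otimes> inv x = a \<otimes> b2 \<otimes> inv a \<otimes> inv b2"
  proof -
    have "x \<otimes> c \<otimes> inv x
        = x \<otimes> a \<otimes> inv x \<otimes> (x \<otimes> b \<otimes> inv x) \<otimes> inv (x \<otimes> a \<otimes> inv x) \<otimes> inv (x \<otimes> b \<otimes> inv x)"
      using c d by (simp add: group_word_simps)
    also have "x \<otimes> a \<otimes> inv x = a"
      using c d commP commute_iff_conj by (metis P.mem_carrier)
    finally show ?thesis
      using 1 eq1[OF c(1)] by simp
  qed
  have cy: "y \<otimes> c \<otimes> inv y = a3 \<otimes> b \<otimes> inv a3 \<otimes> inv b"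
  proof -
    have "y \<otimes> c \<otimes> inv y
        = y \<otimes> a \<otimes> inv y \<otimes> (y \<otimes> b \<otimes> inv y) \<otimes> inv (y \<otimes> a \<otimes> inv y) \<otimes> inv (y \<otimes> b \<otimes> inv y)"
      using c d by (simp add: group_word_simps)
    also have "y \<otimes> b \<otimes> inv y = b"
      using c d commQ commute_iff_conj by (metis Q.mem_carrier)
    finally show ?thesis
      using 2 eq2[OF c(2)] by simp
  qed
  have cyx: "y \<otimes> (x \<otimes> c \<otimes> inv x) \<otimes> inv y = a3 \<otimes> b2 \<otimes> inv a3 \<otimes> inv b2"
  proof -
    have "y \<otimes> (x \<otimes> c \<otimes> inv x) \<otimes> inv y
        = y \<otimes> a \<otimes> inv y \<otimes> (y \<otimes> b2 \<otimes> inv y) \<otimes> inv (y \<otimes> a \<otimes> inv y) \<otimes> inv (y \<otimes> b2 \<otimes> inv y)"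
      unfolding cx using c d 1 by (simp add: group_word_simps)
    also have "y \<otimes> b2 \<otimes> inv y = b2"
      using 1 d commQ commute_iff_conj by (metis Q.mem_carrier)
    finally show ?thesis
      using 2 eq2[OF 1(1)] by simp
  qed
  have cxy: "x \<otimes> (y \<otimes> c \<otimes> inv y) \<otimes> inv x = a3 \<otimes> b2 \<otimes> inv a3 \<otimes> inv b2"
  proof -
    have "x \<otimes> (y \<otimes> c \<otimes> inv y) \<otimes> inv x
        = x \<otimes> a3 \<otimes> inv x \<otimes> (x \<otimes> b \<otimes> inv x) \<otimes> inv (x \<otimes> a3 \<otimes> inv x) \<otimes> inv (x \<otimes> b \<otimes> inv x)"
      unfolding cy using c d 2 by (simp add: group_word_simps)
    also have "x \<otimes> a3 \<otimes> inv x = a3"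
      using 2 d commP commute_iff_conj by (metis P.mem_carrier)
    finally show ?thesis
      using 1 eq1[OF 2(1)] by simp
  qed
  have cc: "c \<in> carrier G" "d \<in> carrier G"
    using assms commutators_carrier by auto
  have "d \<otimes> c \<otimes> inv d = inv x \<otimes> (inv y \<otimes> (x \<otimes> (y \<otimes> c \<otimes> inv y) \<otimes> inv x) \<otimes> y) \<otimes> x"
    using c(1,2) d cc by (simp add: group_word_simps)
  also have "\<dots> = c"
    unfolding cxy cyx[symmetric] using c(1,2) d cc by (simp add: group_word_simps)
  finally show ?thesis
    using commute_iff_conj cc by blast
qed

lemma Comm_commute:
  assumes "k \<in> Comm" "l \<in> Comm"
  shows "k \<otimes> l = l \<otimes> k"
  using generate_commute[OF commutators_carrier commutators_commute] assms unfolding Comm_def by blast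

lemma Comm_swap_subset: "abelian_factorization.Comm G Q P \<subseteq> Comm"
proof -
  interpret S: abelian_factorization G Q P by (rule swap)
  have "S.commutators \<subseteq> Comm"
  proof
    fix c assume "c \<in> S.commutators"
    then obtain x y where "x \<in> P" "y \<in> Q" "c = y \<otimes> x \<otimes> inv y \<otimes> inv x"
      by (auto simp: S.commutators_def)
    moreover from this have "c = inv (x \<otimes> y \<otimes> inv x \<otimes> inv y)"
      by (simp add: group_word_simps)
    ultimately show "c \<in> Comm"
      using Comm.m_inv_closed[OF commutators_Comm] by metis
  qed
  then show ?thesis
    unfolding S.Comm_def by (rule generate_subgroup_incl[OF _ subgroup_Comm])
qed

lemma Comm_swap: "abelian_factorization.Comm G Q P = Comm"
  using Comm_swap_subset abelian_factorization.Comm_swap_subset[OF swap] by (rule subset_antisym)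

text \<open>
  The \<open>Q\<close>-part of \<open>Comm\<close>. It is defined by the exponent, which makes it visibly normal in \<open>G\<close>, and is
  then shown to be \<open>Comm \<inter> Q\<close>.
\<close>

definition CommQ :: "'a set"
  where "CommQ = {k \<in> Comm. k [^] card Q = \<one>}"

text \<open>
  Writing \<open>k = y x\<close> with \<open>y \<in> Q\<close> and \<open>x \<in> P\<close>, the element \<open>x\<close> is congruent to the inverse of \<open>y\<close> modulo the
  normal subgroup \<open>CommQ\<close>. So the power of \<open>x\<close> with exponent \<open>|Q|\<close> lies in \<open>CommQ\<close>. Hence the
  order of \<open>x\<close> is prime to \<open>|P|\<close>, and \<open>x = 1\<close>.
\<close>

lemma Comm_torsion_subset_Q:
  assumes "k \<in> Comm" "k [^] card Q = \<one>"
  shows "k \<in> Q"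
proof -
  let ?n = "card Q"
  obtain y x where yx: "y \<in> Q" "x \<in> P" "k = y \<otimes> x"
    using factor_swap[OF Comm.mem_carrier[OF assms(1)]] by blast
  have CommQ_conj: "g \<otimes> r \<otimes> inv g \<in> CommQ" if "g \<in> carrier G" "r \<in> CommQ" for g r
    using that Comm_conj by (simp add: CommQ_def conj_pow)
  have CommQ_mult: "r \<otimes> s \<in> CommQ" if "r \<in> CommQ" "s \<in> CommQ" for r s
    using that pow_mult_distrib[OF Comm_commute, of r s ?n] by (simp add: CommQ_def)
  have "\<exists>r\<in>CommQ. x [^] j = inv y [^] j \<otimes> r" for j :: nat
  proof (induction j)
    case 0
    have "\<one> \<in> CommQ" by (simp add: CommQ_def)
    then show ?case by (intro bexI[of _ \<one>]) simp_all
  next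
    case (Suc j)
    then obtain r where r: "r \<in> CommQ" "x [^] j = inv y [^] j \<otimes> r" by blast
    have x: "x = inv y \<otimes> k"
      using yx by (simp add: group_word_simps)
    have rc: "r \<in> carrier G" "k \<in> carrier G"
      using r assms(1) by (auto simp: CommQ_def)
    have "x [^] Suc j = inv y [^] j \<otimes> r \<otimes> (inv y \<otimes> k)"
      unfolding nat_pow_Suc r(2) using x by simp
    also have "\<dots> = inv y [^] Suc j \<otimes> ((y \<otimes> r \<otimes> inv y) \<otimes> k)"
      using rc yx(1) by (simp add: group_word_simps)
    finally have "x [^] Suc j = inv y [^] Suc j \<otimes> ((y \<otimes> r \<otimes> inv y) \<otimes> k)" .
    moreover have "(y \<otimes> r \<otimes> inv y) \<otimes> k \<in> CommQ"
      using CommQ_mult[OF CommQ_conj] r(1) assms yx(1) by (simp add: CommQ_def)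
    ultimately show ?case by blast
  qed
  then obtain r where r: "r \<in> CommQ" "x [^] ?n = inv y [^] ?n \<otimes> r" by blast
  have "x [^] (?n * ?n) = (x [^] ?n) [^] ?n"
    using yx(2) by (simp add: nat_pow_pow)
  also have "x [^] ?n = r"
    unfolding r(2) using pow_card_subgroup[OF subQ, of "inv y"] yx(1) r(1) by (simp add: CommQ_def)
  also have "r [^] ?n = \<one>"
    using r(1) by (simp add: CommQ_def)
  finally have "x [^] (?n * ?n) = \<one>" .
  moreover have "x [^] card P = \<one>"
    by (rule pow_card_subgroup[OF subP yx(2)])
  ultimately have "x = \<one>"
    using coprime_PQ yx(2) by (intro coprime_pow_eq_one[of x "card P" "?n * ?n"]) auto
  then show ?thesis using yx(1,3) by simp
qed

lemma CommQ_subset_Q: "CommQ \<subseteq> Q"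
  using Comm_torsion_subset_Q by (auto simp: CommQ_def)

lemma CommQ_eq: "CommQ = Comm \<inter> Q"
  using Comm_torsion_subset_Q pow_card_subgroup[OF subQ] by (auto simp: CommQ_def)

lemma CommQ_normal: "CommQ \<lhd> G"
  using subgroups_Inter_pair[OF subgroup_Comm subQ] Comm_conj
  by (intro normal_invI) (auto simp: CommQ_eq[symmetric], auto simp: CommQ_def conj_pow)

lemma CommQ_Int_P: "x \<in> CommQ \<Longrightarrow> x \<in> P \<Longrightarrow> x = \<one>"
  using CommQ_subset_Q Int_PQ by blast

lemma Comm_factor:
  assumes "k \<in> Comm"
  shows "\<exists>r\<in>CommQ. \<exists>s\<in>Comm \<inter> P. k = r \<otimes> s"
proof -
  interpret S: abelian_factorization G Q P by (rule swap)
  obtain u v where uv: "card P * u = card Q * v + 1"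
    using coprime_PQ bezout_nat[of "card P" "card Q"] card_P_pos by (auto simp: coprime_iff_gcd_eq_1)
  have pow_Comm: "k [^] (j :: nat) \<in> Comm" for j
    using assms by (induction j) auto
  have "k [^] (card P * card Q) = \<one>"
    using pow_order_eq_1[of k] assms by (simp add: card_mult)
  then have one: "k [^] (card P * card Q * j) = \<one>" for j
    using assms by (simp flip: nat_pow_pow)
  define r where "r = k [^] (card P * u)"
  define s where "s = inv (k [^] (card Q * v))"
  have "r [^] card Q = \<one>"
    using one[of u] assms by (simp add: r_def nat_pow_pow mult_ac)
  then have "r \<in> CommQ" using pow_Comm by (simp add: CommQ_def r_def)
  have "s [^] card P = \<one>"
    using one[of v] assms by (simp add: s_def nat_pow_inv nat_pow_pow mult_ac)
  then have "s \<in> Comm \<inter> P"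
    using S.Comm_torsion_subset_Q[of s] pow_Comm by (simp add: s_def Comm_swap)
  moreover have "k = r \<otimes> s"
  proof -
    have "r = k \<otimes> k [^] (card Q * v)"
      using assms nat_pow_mult[of k 1 "card Q * v"] by (simp add: r_def uv)
    then show ?thesis
      using assms by (simp add: s_def m_assoc)
  qed
  ultimately show ?thesis using \<open>r \<in> CommQ\<close> by blast
qed

text \<open>
  The transfer from \<open>G\<close> to \<open>Q\<close>, with \<open>P\<close> as the transversal of the left cosets of \<open>Q\<close>: if \<open>q(g)\<close> denotes the
  \<open>Q\<close>-factor of \<open>g = p(g) q(g)\<close>, it maps \<open>g\<close> to the product of all \<open>q(g x)\<close> with \<open>x \<in> P\<close>.
\<close>

lemma transfer:
  obtains V where "V \<in> hom G (G\<lparr>carrier := Q\<rparr>)"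
    "\<And>y. y \<in> Q \<Longrightarrow> (\<And>x. x \<in> P \<Longrightarrow> x \<otimes> y = y \<otimes> x) \<Longrightarrow> V y = y [^] card P"
proof -
  let ?Q = "G\<lparr>carrier := Q\<rparr>"
  interpret QG: comm_group ?Q
    by (rule subgroup_comm_groupI[OF subQ commQ])
  obtain p q where pq: "\<And>g. g \<in> carrier G \<Longrightarrow> p g \<in> P" "\<And>g. g \<in> carrier G \<Longrightarrow> q g \<in> Q"
    "\<And>g. g \<in> carrier G \<Longrightarrow> p g \<otimes> q g = g"
    using factor by metis
  have pq_eq: "p (x \<otimes> y) = x" "q (x \<otimes> y) = y" if "x \<in> P" "y \<in> Q" for x y
    using factor_unique[of "p (x \<otimes> y)" "q (x \<otimes> y)" x y] pq[of "x \<otimes> y"] that by auto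
  have q_mult: "q (g \<otimes> y) = q g \<otimes> y" if "g \<in> carrier G" "y \<in> Q" for g y
    using pq_eq(2)[of "p g" "q g \<otimes> y"] pq[OF that(1)] that
    by (metis P.mem_carrier Q.m_closed Q.mem_carrier m_assoc)
  have split: "q (g \<otimes> h \<otimes> x) = q (g \<otimes> p (h \<otimes> x)) \<otimes> q (h \<otimes> x)"
    if "g \<in> carrier G" "h \<in> carrier G" "x \<in> P" for g h x
  proof -
    have "g \<otimes> h \<otimes> x = g \<otimes> p (h \<otimes> x) \<otimes> q (h \<otimes> x)"
      using that pq[of "h \<otimes> x"] by (simp add: m_assoc)
    then show ?thesis
      using that pq[of "h \<otimes> x"] q_mult[of "g \<otimes> p (h \<otimes> x)" "q (h \<otimes> x)"] by simp
  qed
  have inj: "inj_on (\<lambda>x. p (h \<otimes> x)) P" if h: "h \<in> carrier G" for h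
  proof (rule inj_onI)
    fix x x' assume x: "x \<in> P" "x' \<in> P" "p (h \<otimes> x) = p (h \<otimes> x')"
    define a where "a = p (h \<otimes> x)"
    have a: "a \<in> carrier G" unfolding a_def using h x pq by simp
    define b where "b = q (h \<otimes> x)"
    define b' where "b' = q (h \<otimes> x')"
    have b: "b \<in> Q" "b' \<in> Q" using h x pq by (auto simp: b_def b'_def)
    have eqs: "h \<otimes> x = a \<otimes> b" "h \<otimes> x' = a \<otimes> b'"
      using h x pq(3)[of "h \<otimes> x"] pq(3)[of "h \<otimes> x'"] by (auto simp: a_def b_def b'_def)
    have "inv x \<otimes> x' = inv (h \<otimes> x) \<otimes> (h \<otimes> x')"
      using h x by (simp add: group_word_simps)
    also have "\<dots> = inv b \<otimes> b'"
      unfolding eqs using a b by (simp add: group_word_simps)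
    finally have "inv x \<otimes> x' \<in> Q" using b by simp
    then have "inv x \<otimes> x' = \<one>" using x by (intro Int_PQ) auto
    then show "x = x'"
      using x by (metis P.mem_carrier inv_closed inv_equality inv_inv inv_comm)
  qed
  define V where "V = (\<lambda>g. finprod ?Q (\<lambda>x. q (g \<otimes> x)) P)"
  have qQ: "(\<lambda>x. q (g \<otimes> x)) \<in> P \<rightarrow> carrier ?Q" if "g \<in> carrier G" for g
    using that pq by auto
  have "V \<in> hom G ?Q"
  proof (rule homI)
    show "V g \<in> carrier ?Q" if "g \<in> carrier G" for g
      unfolding V_def by (rule QG.finprod_closed[OF qQ[OF that]])
    fix g h assume gh: "g \<in> carrier G" "h \<in> carrier G"
    \<comment> \<open>Left multiplication by \<open>h\<close> permutes the cosets, so the factors can be reindexed.\<close>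
    have img: "(\<lambda>x. p (h \<otimes> x)) ` P = P"
      using inj gh pq finite_P by (intro endo_inj_surj) auto
    have "V (g \<otimes> h) = finprod ?Q (\<lambda>x. q (g \<otimes> p (h \<otimes> x)) \<otimes>\<^bsub>?Q\<^esub> q (h \<otimes> x)) P"
      unfolding V_def using gh pq split by (intro QG.finprod_cong') auto
    also have "\<dots> = finprod ?Q (\<lambda>x. q (g \<otimes> p (h \<otimes> x))) P \<otimes>\<^bsub>?Q\<^esub> finprod ?Q (\<lambda>x. q (h \<otimes> x)) P"
      using gh pq by (intro QG.finprod_multf) auto
    also have "finprod ?Q (\<lambda>x. q (g \<otimes> p (h \<otimes> x))) P = V g"
      using QG.finprod_reindex[of "\<lambda>x. q (g \<otimes> x)" "\<lambda>x. p (h \<otimes> x)" P] qQ[OF gh(1)] inj[OF gh(2)]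
      by (simp add: img V_def)
    finally show "V (g \<otimes> h) = V g \<otimes>\<^bsub>?Q\<^esub> V h" by (simp add: V_def)
  qed
  moreover have "V y = y [^] card P" if "y \<in> Q" "\<And>x. x \<in> P \<Longrightarrow> x \<otimes> y = y \<otimes> x" for y
  proof -
    have "V y = finprod ?Q (\<lambda>x. y) P"
      unfolding V_def using that pq_eq(2)[OF _ that(1)]
      by (intro QG.finprod_cong') (auto simp flip: that(2))
    then show ?thesis
      using that QG.finprod_const[of y P] by (simp flip: nat_pow_consistent)
  qed
  ultimately show ?thesis using that by blast
qed

lemma CommQ_central_trivial:
  assumes "c \<in> CommQ" "\<And>x. x \<in> P \<Longrightarrow> x \<otimes> c = c \<otimes> x"
  shows "c = \<one>"
proof -
  let ?Q = "G\<lparr>carrier := Q\<rparr>"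
  interpret QG: comm_group ?Q
    by (rule subgroup_comm_groupI[OF subQ commQ])
  obtain V where V: "V \<in> hom G ?Q"
    "\<And>y. y \<in> Q \<Longrightarrow> (\<And>x. x \<in> P \<Longrightarrow> x \<otimes> y = y \<otimes> x) \<Longrightarrow> V y = y [^] card P"
    using transfer by blast
  interpret V: group_hom G ?Q V
    using V(1) by unfold_locales
  have cQ: "c \<in> Q" using assms(1) CommQ_subset_Q by blast
  have "commutators \<subseteq> kernel G ?Q V"
  proof
    fix d assume "d \<in> commutators"
    then obtain x y where d: "x \<in> P" "y \<in> Q" "d = x \<otimes> y \<otimes> inv x \<otimes> inv y"
      by (auto simp: commutators_def)
    then have "V d = V x \<otimes> V y \<otimes> inv (V x) \<otimes> inv (V y)"
      using V.hom_closed subQ by (simp add: V.hom_mult)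
    also have "V x \<otimes> V y = V y \<otimes> V x"
      using d V.hom_closed commQ by simp
    also have "V y \<otimes> V x \<otimes> inv (V x) \<otimes> inv (V y) = \<one>\<^bsub>?Q\<^esub>"
      using d V.hom_closed by (simp add: group_word_simps)
    finally show "d \<in> kernel G ?Q V"
      using d by (auto simp: kernel_def)
  qed
  then have "Comm \<subseteq> kernel G ?Q V"
    unfolding Comm_def by (intro generate_subgroup_incl V.subgroup_kernel)
  then have "V c = \<one>"
    using assms(1) by (auto simp: CommQ_def kernel_def)
  then have "c [^] card P = \<one>"
    using V(2)[OF cQ assms(2)] by simp
  then show ?thesis
    using coprime_pow_eq_one[OF _ _ pow_card_subgroup[OF subQ cQ] coprime_PQ] cQ by simp
qed

text \<open>
  The normaliser of \<open>P\<close> in \<open>Q\<close>. As \<open>P\<close> is finite, it suffices to ask that conjugation maps \<open>P\<close> into itself.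
\<close>

definition NormQ :: "'a set"
  where "NormQ = {y \<in> Q. \<forall>z\<in>P. y \<otimes> z \<otimes> inv y \<in> P}"

lemma NormQ_inv:
  assumes "y \<in> NormQ" "z \<in> P"
  shows "inv y \<otimes> z \<otimes> y \<in> P"
proof -
  have y: "y \<in> Q" "\<And>z. z \<in> P \<Longrightarrow> y \<otimes> z \<otimes> inv y \<in> P"
    using assms(1) by (auto simp: NormQ_def)
  have "inj_on (\<lambda>z. y \<otimes> z \<otimes> inv y) P"
    using y(1) by (intro inj_onI) simp
  then have "(\<lambda>z. y \<otimes> z \<otimes> inv y) ` P = P"
    using y(2) finite_P by (intro endo_inj_surj) auto
  then obtain w where "w \<in> P" "z = y \<otimes> w \<otimes> inv y"
    using assms(2) by blast
  then show ?thesis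
    using y(1) by (simp add: group_word_simps)
qed

lemma subgroup_NormQ: "subgroup NormQ G"
proof (rule subgroupI)
  show "NormQ \<noteq> {}" by (auto simp: NormQ_def intro!: exI[of _ \<one>])
  show "inv a \<in> NormQ" if "a \<in> NormQ" for a
    using that NormQ_inv by (auto simp: NormQ_def)
  fix a b assume ab: "a \<in> NormQ" "b \<in> NormQ"
  have "a \<otimes> b \<otimes> z \<otimes> inv (a \<otimes> b) \<in> P" if "z \<in> P" for z
  proof -
    have "a \<otimes> b \<otimes> z \<otimes> inv (a \<otimes> b) = a \<otimes> (b \<otimes> z \<otimes> inv b) \<otimes> inv a"
      using ab that by (simp add: NormQ_def group_word_simps)
    then show ?thesis using ab that by (simp add: NormQ_def)
  qed
  then show "a \<otimes> b \<in> NormQ"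
    using ab by (simp add: NormQ_def)
qed (auto simp: NormQ_def)

lemma NormQ_subset_Q: "NormQ \<subseteq> Q"
  by (auto simp: NormQ_def)

lemma Q_factor:
  assumes y: "y \<in> Q"
  shows "\<exists>r\<in>CommQ. \<exists>c\<in>NormQ. y = r \<otimes> c"
proof -
  interpret CommQ: normal CommQ G by (rule CommQ_normal)
  have "\<exists>r\<in>CommQ. \<exists>p\<in>P. y \<otimes> z \<otimes> inv y = r \<otimes> p" if z: "z \<in> P" for z
  proof -
    have "inv (z \<otimes> y \<otimes> inv z \<otimes> inv y) \<in> Comm"
      using commutators_Comm y z by simp
    then obtain r s where rs: "r \<in> CommQ" "s \<in> P" "inv (z \<otimes> y \<otimes> inv z \<otimes> inv y) = r \<otimes> s"
      using Comm_factor by blast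
    \<comment> \<open>The inverse of the commutator \<open>[z, y]\<close> splits as \<open>r s\<close>, and its factor \<open>s\<close> is absorbed into \<open>P\<close>.\<close>
    have "y \<otimes> z \<otimes> inv y = inv (z \<otimes> y \<otimes> inv z \<otimes> inv y) \<otimes> z"
      using y z by (simp add: group_word_simps)
    also have "\<dots> = r \<otimes> (s \<otimes> z)"
      unfolding rs(3) using rs(1,2) z by (simp add: m_assoc)
    finally have "y \<otimes> z \<otimes> inv y = r \<otimes> (s \<otimes> z)" .
    moreover have "s \<otimes> z \<in> P" using rs(2) z by simp
    ultimately show ?thesis using rs(1) by blast
  qed
  then obtain t where t: "t \<in> CommQ" "\<forall>z\<in>P. (t \<otimes> y) \<otimes> z \<otimes> inv (t \<otimes> y) \<in> P"
    using coprime_complement_normalizer[OF subP finite_P CommQ_normal _ _ coprime_PQ Q.mem_carrier[OF y]]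
      Comm_commute unfolding CommQ_def by blast
  then have "t \<otimes> y \<in> NormQ"
    using y CommQ_subset_Q by (auto simp: NormQ_def)
  moreover have "y = inv t \<otimes> (t \<otimes> y)"
    using y t(1) by (simp add: group_word_simps)
  ultimately show ?thesis using t(1) by blast
qed

lemma CommQ_Int_NormQ:
  assumes "c \<in> CommQ" "c \<in> NormQ"
  shows "c = \<one>"
proof (rule CommQ_central_trivial[OF assms(1)])
  interpret CommQ: normal CommQ G by (rule CommQ_normal)
  fix x assume x: "x \<in> P"
  \<comment> \<open>The commutator of \<open>c\<close> and \<open>x\<close> lies in \<open>P\<close> as \<open>c\<close> normalises \<open>P\<close>, and in the normal subgroup \<open>CommQ\<close>.\<close>
  have "c \<otimes> x \<otimes> inv c \<otimes> inv x \<in> P"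
    using assms(2) x by (simp add: NormQ_def)
  moreover have "c \<otimes> (x \<otimes> inv c \<otimes> inv x) \<in> CommQ"
    using assms(1) x CommQ.inv_op_closed2 by simp
  ultimately have "c \<otimes> x \<otimes> inv c \<otimes> inv x = \<one>"
    using assms(1) x CommQ_Int_P by (simp add: m_assoc)
  then show "x \<otimes> c = c \<otimes> x"
    using assms(1) x by (metis CommQ.mem_carrier P.mem_carrier m_closed inv_closed inv_equality inv_inv commute_iff_conj)
qed

lemma NormQ_swap_commute:
  assumes "y \<in> NormQ" "x \<in> abelian_factorization.NormQ G Q P"
  shows "y \<otimes> x = x \<otimes> y"
proof -
  interpret S: abelian_factorization G Q P by (rule swap)
  have xy: "x \<in> P" "y \<in> Q" using assms by (auto simp: S.NormQ_def NormQ_def)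
  have "y \<otimes> x \<otimes> inv y \<otimes> inv x \<in> P"
    using assms(1) xy by (simp add: NormQ_def)
  moreover have "y \<otimes> (x \<otimes> inv y \<otimes> inv x) \<in> Q"
    using assms(2) xy by (simp add: S.NormQ_def)
  ultimately have "y \<otimes> x \<otimes> inv y \<otimes> inv x = \<one>"
    using xy Int_PQ by (simp add: m_assoc)
  then show ?thesis
    using xy by (metis Q.mem_carrier P.mem_carrier m_closed inv_closed inv_equality inv_inv commute_iff_conj)
qed

text \<open>
  \<open>G\<close> is the internal direct product of \<open>M V\<close> and \<open>N U\<close>, where \<open>M\<close> and \<open>N\<close> are the \<open>Q\<close>-part and the \<open>P\<close>-part of
  \<open>Comm\<close>, \<open>U\<close> is the normaliser of \<open>P\<close> in \<open>Q\<close>, and \<open>V\<close> is the normaliser of \<open>Q\<close> in \<open>P\<close>. Each of the two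
  factors is a semidirect product of abelian groups of coprime orders.
\<close>

theorem direct_decomposition:
  obtains M N U V where
    "M \<lhd> G" "N \<lhd> G" "subgroup U G" "subgroup V G" "M \<subseteq> Q" "U \<subseteq> Q" "N \<subseteq> P" "V \<subseteq> P"
    "\<And>a b. a \<in> M <#> V \<Longrightarrow> b \<in> N <#> U \<Longrightarrow> a \<otimes> b = b \<otimes> a"
    "(M <#> V) \<inter> (N <#> U) \<subseteq> {\<one>}"
    "carrier G \<subseteq> (M <#> V) <#> (N <#> U)"
proof -
  interpret S: abelian_factorization G Q P by (rule swap)
  interpret NR: normal CommQ G by (rule CommQ_normal)
  interpret NS: normal S.CommQ G by (rule S.CommQ_normal)
  interpret NormQ: subgroup NormQ G by (rule subgroup_NormQ)
  interpret D: subgroup S.NormQ G by (rule S.subgroup_NormQ)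
  have RS: "r \<otimes> s = s \<otimes> r" if "r \<in> CommQ" "s \<in> S.CommQ" for r s
    using that Comm_commute by (simp add: CommQ_def S.CommQ_def Comm_swap)
  have commute: "a \<otimes> b = b \<otimes> a" if ab: "a \<in> CommQ <#> S.NormQ" "b \<in> S.CommQ <#> NormQ" for a b
  proof -
    obtain r x where a: "r \<in> CommQ" "x \<in> S.NormQ" "a = r \<otimes> x"
      using ab(1) by (auto simp: set_mult_def)
    obtain s y where b: "s \<in> S.CommQ" "y \<in> NormQ" "b = s \<otimes> y"
      using ab(2) by (auto simp: set_mult_def)
    have carr: "r \<in> carrier G" "x \<in> carrier G" "s \<in> carrier G" "y \<in> carrier G"
      using a b by auto
    have "r \<in> Q" "x \<in> P" "s \<in> P" "y \<in> Q"
      using CommQ_subset_Q NormQ_subset_Q S.CommQ_subset_Q S.NormQ_subset_Q a b by auto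
    then have "s \<otimes> r = r \<otimes> s" "y \<otimes> r = r \<otimes> y" "s \<otimes> x = x \<otimes> s" "y \<otimes> x = x \<otimes> y"
      using RS[OF a(1) b(1)] commQ commP NormQ_swap_commute[OF b(2) a(2)] by metis+
    then have "s \<in> {g \<in> carrier G. g \<otimes> r = r \<otimes> g}" "y \<in> {g \<in> carrier G. g \<otimes> r = r \<otimes> g}"
      "s \<in> {g \<in> carrier G. g \<otimes> x = x \<otimes> g}" "y \<in> {g \<in> carrier G. g \<otimes> x = x \<otimes> g}"
      using carr by auto
    then have "r \<in> {g \<in> carrier G. g \<otimes> b = b \<otimes> g}" "x \<in> {g \<in> carrier G. g \<otimes> b = b \<otimes> g}"
      using subgroup.m_closed[OF commuting_subgroup, of r s y]
        subgroup.m_closed[OF commuting_subgroup, of x s y] carr b(3) by auto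
    then show ?thesis
      using subgroup.m_closed[OF commuting_subgroup, of b r x] carr a(3) b(3) by auto
  qed
  have inter: "(CommQ <#> S.NormQ) \<inter> (S.CommQ <#> NormQ) \<subseteq> {\<one>}"
  proof
    fix a assume "a \<in> (CommQ <#> S.NormQ) \<inter> (S.CommQ <#> NormQ)"
    then obtain r x s y where a: "r \<in> CommQ" "x \<in> S.NormQ" "a = r \<otimes> x" "s \<in> S.CommQ" "y \<in> NormQ" "a = s \<otimes> y"
      by (auto simp: set_mult_def)
    have mem: "r \<in> Q" "y \<in> Q" "x \<in> P"
      using a CommQ_subset_Q NormQ_subset_Q S.NormQ_subset_Q by auto
    \<comment> \<open>From \<open>r x = s y\<close>, the quotient \<open>y\<^sup>-\<^sup>1 r\<close> lies both in \<open>Q\<close> and in \<open>P\<close>.\<close>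
    have "inv y \<otimes> r = inv y \<otimes> (r \<otimes> x) \<otimes> inv x"
      using a(1,2,4,5) by (simp add: group_word_simps)
    also have "\<dots> = (inv y \<otimes> s \<otimes> y) \<otimes> inv x"
      unfolding a(3)[symmetric] unfolding a(6) using a(1,2,4,5) by (simp add: group_word_simps)
    also have "\<dots> \<in> P"
      using NS.inv_op_closed1[of y s] a(4,5) mem(3) S.CommQ_subset_Q by auto
    finally have "inv y \<otimes> r \<in> P" .
    then have "inv y \<otimes> r = \<one>"
      using mem by (intro Int_PQ) auto
    then have "r = y"
      using mem by (metis Q.mem_carrier inv_closed inv_equality inv_inv)
    then have ry: "r = \<one>" "y = \<one>" using CommQ_Int_NormQ a by auto
    then have "x = s" using a(2-4,6) by simp
    then have "x = \<one>" using S.CommQ_Int_NormQ a by auto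
    then show "a \<in> {\<one>}" using a ry by simp
  qed
  have cover: "carrier G \<subseteq> (CommQ <#> S.NormQ) <#> (S.CommQ <#> NormQ)"
  proof
    fix g assume "g \<in> carrier G"
    then obtain p q where pq: "p \<in> P" "q \<in> Q" "g = p \<otimes> q" using factor by blast
    obtain s x where sx: "s \<in> S.CommQ" "x \<in> S.NormQ" "p = s \<otimes> x" using S.Q_factor pq(1) by blast
    obtain r y where ry: "r \<in> CommQ" "y \<in> NormQ" "q = r \<otimes> y" using Q_factor pq(2) by blast
    \<comment> \<open>Moving \<open>x\<close> past \<open>r\<close> in \<open>g = s x r y\<close> replaces \<open>r\<close> by its conjugate \<open>r'\<close>.\<close>
    define r' where "r' = x \<otimes> r \<otimes> inv x"
    have r': "r' \<in> CommQ" unfolding r'_def using NR.inv_op_closed2[of x r] ry(1) sx(2) by simp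
    have sP: "s \<in> P" "x \<in> P" using sx S.CommQ_subset_Q S.NormQ_subset_Q by auto
    have carr: "r' \<in> carrier G" "x \<in> carrier G" "s \<in> carrier G" "y \<in> carrier G" "r \<in> carrier G"
      using r' sx ry by auto
    have "g = s \<otimes> r' \<otimes> x \<otimes> y"
      unfolding pq(3) sx(3) ry(3) r'_def using carr by (simp add: group_word_simps)
    also have "s \<otimes> r' = r' \<otimes> s" using RS[OF r' sx(1)] by simp
    also have "r' \<otimes> s \<otimes> x \<otimes> y = r' \<otimes> (s \<otimes> x) \<otimes> y"
      using carr by (simp add: m_assoc)
    also have "s \<otimes> x = x \<otimes> s" using sP commP by simp
    also have "r' \<otimes> (x \<otimes> s) \<otimes> y = (r' \<otimes> x) \<otimes> (s \<otimes> y)"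
      using carr by (simp add: m_assoc)
    finally show "g \<in> (CommQ <#> S.NormQ) <#> (S.CommQ <#> NormQ)"
      using r' sx ry unfolding set_mult_def by blast
  qed
  show ?thesis
    by (rule that[OF CommQ_normal S.CommQ_normal subgroup_NormQ S.subgroup_NormQ CommQ_subset_Q NormQ_subset_Q S.CommQ_subset_Q S.NormQ_subset_Q
          commute inter cover])
qed

end

section \<open>Membership in the class of \<open>A'\<close>-groups\<close>

text \<open>
  The action is restricted to \<open>N\<close> because \<^const>\<open>AutoGroup\<close> consists of extensional functions.
\<close>

lemma (in group) internal_semidirect_product:
  assumes "N \<lhd> G" "subgroup H G" "N \<inter> H \<subseteq> {\<one>}"
  defines "\<mu> \<equiv> \<lambda>h. \<lambda>n\<in>N. h \<otimes> n \<otimes> inv h"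
  shows "\<mu> \<in> hom (G\<lparr>carrier := H\<rparr>) (AutoGroup (G\<lparr>carrier := N\<rparr>))"
    and "G\<lparr>carrier := N <#> H\<rparr> \<cong> semidirect_product (G\<lparr>carrier := N\<rparr>) \<mu> (G\<lparr>carrier := H\<rparr>)"
proof -
  interpret N: normal N G by fact
  interpret H: subgroup H G by fact
  let ?N = "G\<lparr>carrier := N\<rparr>" and ?H = "G\<lparr>carrier := H\<rparr>"
  have conj: "h \<otimes> n \<otimes> inv h \<in> N" if "h \<in> carrier G" "n \<in> N" for h n
    using that by (rule N.inv_op_closed2)
  have bij: "bij_betw (\<mu> h) N N" if h: "h \<in> carrier G" for h
  proof (rule bij_betw_byWitness[where f' = "\<mu> (inv h)"])
    show "\<forall>n\<in>N. \<mu> (inv h) (\<mu> h n) = n" "\<forall>n\<in>N. \<mu> h (\<mu> (inv h) n) = n"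
      using h conj[OF h] conj[of "inv h"] by (auto simp: \<mu>_def group_word_simps)
    show "\<mu> h ` N \<subseteq> N" "\<mu> (inv h) ` N \<subseteq> N"
      using h conj[OF h] conj[of "inv h"] by (auto simp: \<mu>_def)
  qed
  have auto: "\<mu> h \<in> auto ?N" if h: "h \<in> carrier G" for h
    using bij[OF h] h conj[OF h]
    by (auto simp: auto_def Bij_def hom_def \<mu>_def group_word_simps)
  show mu: "\<mu> \<in> hom ?H (AutoGroup ?N)"
  proof (rule homI)
    show "\<mu> h \<in> carrier (AutoGroup ?N)" if "h \<in> carrier ?H" for h
      using auto that by (simp add: AutoGroup_def)
    fix g h assume gh: "g \<in> carrier ?H" "h \<in> carrier ?H"
    have "\<mu> (g \<otimes> h) = compose N (\<mu> g) (\<mu> h)"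
      using gh conj by (auto simp: fun_eq_iff compose_def \<mu>_def group_word_simps)
    then show "\<mu> (g \<otimes>\<^bsub>?H\<^esub> h) = \<mu> g \<otimes>\<^bsub>AutoGroup ?N\<^esub> \<mu> h"
      using auto gh by (auto simp: AutoGroup_def BijGroup_def auto_def)
  qed
  let ?S = "semidirect_product ?N \<mu> ?H"
  interpret NH: group_disjoint_sum G N H ..
  have "(\<lambda>(n, h). n \<otimes> h) \<in> iso ?S (G\<lparr>carrier := N <#> H\<rparr>)"
  proof (rule isoI)
    show "(\<lambda>(n, h). n \<otimes> h) \<in> hom ?S (G\<lparr>carrier := N <#> H\<rparr>)"
      by (rule homI) (auto simp: semidirect_product_def set_mult_def \<mu>_def group_word_simps)
    show "bij_betw (\<lambda>(n, h). n \<otimes> h) (carrier ?S) (carrier (G\<lparr>carrier := N <#> H\<rparr>))"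
      using NH.cancel assms(3) unfolding bij_betw_def inj_on_def
      by (auto simp: semidirect_product_def set_mult_def image_iff)
  qed
  then show "G\<lparr>carrier := N <#> H\<rparr> \<cong> ?S"
    using group.iso_sym[OF group_semidirect_product[OF subgroup_imp_group subgroup_imp_group mu]]
      N.subgroup_axioms assms(2) unfolding is_iso_def by blast
qed

lemma (in group) internal_direct_product:
  assumes "subgroup A G" "subgroup B G" "A \<inter> B \<subseteq> {\<one>}" "carrier G \<subseteq> A <#> B"
    and "\<And>a b. a \<in> A \<Longrightarrow> b \<in> B \<Longrightarrow> a \<otimes> b = b \<otimes> a"
  shows "G \<cong> G\<lparr>carrier := A\<rparr> \<times>\<times> G\<lparr>carrier := B\<rparr>"
proof -
  interpret A: subgroup A G by fact
  interpret B: subgroup B G by fact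
  interpret AB: group_disjoint_sum G A B ..
  let ?D = "G\<lparr>carrier := A\<rparr> \<times>\<times> G\<lparr>carrier := B\<rparr>"
  have "(\<lambda>(a, b). a \<otimes> b) \<in> iso ?D G"
  proof (rule isoI)
    show "(\<lambda>(a, b). a \<otimes> b) \<in> hom ?D G"
    proof (rule homI)
      fix x y assume "x \<in> carrier ?D" "y \<in> carrier ?D"
      then obtain a b a' b' where ab: "x = (a, b)" "y = (a', b')" "a \<in> A" "b \<in> B" "a' \<in> A" "b' \<in> B"
        by auto
      have "a \<otimes> a' \<otimes> (b \<otimes> b') = a \<otimes> (a' \<otimes> b) \<otimes> b'"
        using ab by (simp add: m_assoc)
      also have "\<dots> = a \<otimes> b \<otimes> (a' \<otimes> b')"
        unfolding assms(5)[OF ab(5,4)] using ab by (simp add: m_assoc)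
      finally show "(\<lambda>(a, b). a \<otimes> b) (x \<otimes>\<^bsub>?D\<^esub> y) = (\<lambda>(a, b). a \<otimes> b) x \<otimes> (\<lambda>(a, b). a \<otimes> b) y"
        using ab by simp
    qed auto
    show "bij_betw (\<lambda>(a, b). a \<otimes> b) (carrier ?D) (carrier G)"
      using AB.cancel assms(3,4) unfolding bij_betw_def inj_on_def
      by (auto simp: set_mult_def image_iff)
  qed
  then show ?thesis
    using group.iso_sym[OF DirProd_group[OF subgroup_imp_group subgroup_imp_group]] assms(1,2)
    unfolding is_iso_def by blast
qed

lemma A'_group_nat_internal_semidirect:
  fixes G :: "nat monoid"
  assumes "group G" "finite (carrier G)" "N \<lhd> G" "subgroup H G" "coprime (card N) (card H)"
    and "comm_group (G\<lparr>carrier := N\<rparr>)" "comm_group (G\<lparr>carrier := H\<rparr>)"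
  shows "A'_group_nat (G\<lparr>carrier := N <#>\<^bsub>G\<^esub> H\<rparr>)"
proof -
  interpret group G by fact
  interpret N: normal N G by fact
  interpret H: subgroup H G by fact
  have fin: "finite N" "finite H"
    using assms(2) N.subset H.subset finite_subset by blast+
  have Int: "N \<inter> H \<subseteq> {\<one>\<^bsub>G\<^esub>}"
    using coprime_card_Int[OF N.subgroup_axioms assms(4,5)] by blast
  show ?thesis
  proof (rule A'_group_nat.semidirect)
    show "A'_group_nat (G\<lparr>carrier := H\<rparr>)"
      using assms(7) fin by (intro A'_group_nat.abelian) auto
    show "group (G\<lparr>carrier := N <#>\<^bsub>G\<^esub> H\<rparr>)"
      using assms(3,4) by (intro subgroup_imp_group mult_norm_subgroup)
  qed (use assms fin internal_semidirect_product[OF assms(3,4) Int] in \<open>simp_all add: order_def\<close>)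
qed

lemma A'_group_nat_abelian_factorization:
  fixes G :: "nat monoid"
  assumes "abelian_factorization G P Q"
  shows "A'_group_nat G"
proof -
  interpret abelian_factorization G P Q by fact
  obtain R S C D where *: "R \<lhd> G" "S \<lhd> G" "subgroup C G" "subgroup D G"
    and sub: "R \<subseteq> Q" "C \<subseteq> Q" "S \<subseteq> P" "D \<subseteq> P"
    and comm: "\<And>a b. a \<in> R <#>\<^bsub>G\<^esub> D \<Longrightarrow> b \<in> S <#>\<^bsub>G\<^esub> C \<Longrightarrow> a \<otimes>\<^bsub>G\<^esub> b = b \<otimes>\<^bsub>G\<^esub> a"
    and Int: "(R <#>\<^bsub>G\<^esub> D) \<inter> (S <#>\<^bsub>G\<^esub> C) \<subseteq> {\<one>\<^bsub>G\<^esub>}"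
    and cover: "carrier G \<subseteq> (R <#>\<^bsub>G\<^esub> D) <#>\<^bsub>G\<^esub> (S <#>\<^bsub>G\<^esub> C)"
    by (rule direct_decomposition) (rule that)
  note sg = normal_imp_subgroup[OF *(1)] normal_imp_subgroup[OF *(2)] *(3,4)
  have comms: "comm_group (G\<lparr>carrier := R\<rparr>)" "comm_group (G\<lparr>carrier := S\<rparr>)"
    "comm_group (G\<lparr>carrier := C\<rparr>)" "comm_group (G\<lparr>carrier := D\<rparr>)"
    using sub commP commQ sg by (auto intro!: subgroup_comm_groupI simp: subset_iff)
  have cop: "coprime (card R) (card D)" "coprime (card S) (card C)"
    using card_subgroup_dvd[OF sg(1) subQ sub(1)] card_subgroup_dvd[OF sg(2) subP sub(3)]
      card_subgroup_dvd[OF sg(3) subQ sub(2)] card_subgroup_dvd[OF sg(4) subP sub(4)] coprime_PQ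
    by (meson coprime_commute coprime_divisors)+
  show ?thesis
  proof (rule A'_group_nat.direct)
    show "A'_group_nat (G\<lparr>carrier := R <#>\<^bsub>G\<^esub> D\<rparr>)" "A'_group_nat (G\<lparr>carrier := S <#>\<^bsub>G\<^esub> C\<rparr>)"
      using A'_group_nat_internal_semidirect[OF group_axioms finite_G] * comms cop by auto
    show "G \<cong> G\<lparr>carrier := R <#>\<^bsub>G\<^esub> D\<rparr> \<times>\<times> G\<lparr>carrier := S <#>\<^bsub>G\<^esub> C\<rparr>"
      by (rule internal_direct_product[OF mult_norm_subgroup mult_norm_subgroup Int cover comm])
        (use * in auto)
  qed (rule group_axioms)
qed

lemma (in group) nat_copy:
  assumes "finite (carrier G)"
  obtains K :: "nat monoid" and f where "group K" "f \<in> iso G K"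
proof -
  obtain f :: "'a \<Rightarrow> nat" where f: "inj_on f (carrier G)"
    using finite_imp_inj_to_nat_seg[OF assms] by blast
  have "f a = f b \<longleftrightarrow> a \<otimes> inv b \<in> {\<one>}" if "a \<in> carrier G" "b \<in> carrier G" for a b
    using that f by (metis inj_on_eq_iff inv_closed inv_equality inv_inv r_inv singleton_iff)
  then have "group (image_group f G)"
    using one_is_normal by (intro image_group_is_group weak_group_morphismsI)
  moreover have "f \<in> iso G (image_group f G)"
    using f by (auto simp: iso_def hom_def image_group_def bij_betw_def)
  ultimately show ?thesis by (rule that)
qed

lemma (in abelian_factorization) image_iso:
  assumes "group H" "f \<in> iso G H"
  shows "abelian_factorization H (f ` P) (f ` Q)"
proof -
  interpret H: group H by fact
  interpret f: group_hom G H f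
    using assms(2) by unfold_locales (auto simp: iso_def)
  have bij: "bij_betw f (carrier G) (carrier H)"
    using assms(2) by (auto simp: iso_def)
  have "card (f ` P) = card P" "card (f ` Q) = card Q"
    using bij P.subset Q.subset by (auto intro!: card_image simp: bij_betw_def inj_on_subset)
  then have cop: "coprime (card (f ` P)) (card (f ` Q))"
    using coprime_PQ by simp
  show ?thesis
  proof (intro abelian_factorization.intro abelian_factorization_axioms.intro)
    show "finite (carrier H)" using bij finite_G by (simp add: bij_betw_finite)
    show "subgroup (f ` P) H" "subgroup (f ` Q) H"
      using f.subgroup_img_is_subgroup subP subQ by auto
    show "x \<otimes>\<^bsub>H\<^esub> y = y \<otimes>\<^bsub>H\<^esub> x" if "x \<in> f ` P" "y \<in> f ` P" for x y
      using that commP by (auto simp flip: f.hom_mult)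
    show "x \<otimes>\<^bsub>H\<^esub> y = y \<otimes>\<^bsub>H\<^esub> x" if "x \<in> f ` Q" "y \<in> f ` Q" for x y
      using that commQ by (auto simp flip: f.hom_mult)
    fix g assume "g \<in> carrier H"
    then obtain h where "h \<in> carrier G" "g = f h" using bij by (auto simp: bij_betw_def)
    moreover from this obtain x y where "x \<in> P" "y \<in> Q" "h = x \<otimes> y" using factor by blast
    ultimately show "\<exists>x\<in>f ` P. \<exists>y\<in>f ` Q. g = x \<otimes>\<^bsub>H\<^esub> y" by auto
  qed (use assms(1) cop in auto)
qed

lemma A_group_abelian_factorization:
  fixes G (structure)
  assumes "A_group G" "card {p :: nat. Factorial_Ring.prime p \<and> p dvd order G} \<le> 2"
  obtains P Q where "abelian_factorization G P Q"
proof -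
  interpret group G using assms(1) by (simp add: A_group_def)
  have fin: "finite (carrier G)" using assms(1) by (simp add: A_group_def)
  have pos: "order G > 0" using fin by (simp add: order_gt_0_iff_finite)
  define D where "D = {p :: nat. Factorial_Ring.prime p \<and> p dvd order G}"
  \<comment> \<open>\<open>D\<close> may have fewer than two elements; it is enlarged by arbitrary primes, whose Sylow subgroups are trivial.\<close>
  have finD: "finite D"
    by (rule finite_subset[OF _ finite_divisors_nat[OF pos]]) (auto simp: D_def)
  obtain Y where Y: "Y \<subseteq> {p :: nat. Factorial_Ring.prime p}" "D \<subseteq> Y" "card Y = 2" "finite Y"
  proof -
    have "infinite ({p :: nat. Factorial_Ring.prime p} - D)"
      using primes_infinite finD by simp
    then obtain Z where Z: "Z \<subseteq> {p :: nat. Factorial_Ring.prime p} - D" "card Z = 2 - card D" "finite Z"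
      using infinite_arbitrarily_large by metis
    then have "card (D \<union> Z) = 2"
      using finD assms(2) by (subst card_Un_disjoint) (auto simp: D_def)
    then show ?thesis
      using Z finD that[of "D \<union> Z"] by (auto simp: D_def)
  qed
  then obtain p q where pq: "Y = {p, q}" "p \<noteq> q" by (auto simp: card_2_iff)
  then have primes: "Factorial_Ring.prime p" "Factorial_Ring.prime q" using Y by auto
  let ?a = "p ^ multiplicity p (order G)" and ?b = "q ^ multiplicity q (order G)"
  have "order G = (\<Prod>r\<in>prime_factors (order G). r ^ multiplicity r (order G))"
    using pos prime_factorization_nat by blast
  also have "\<dots> = (\<Prod>r\<in>{p, q}. r ^ multiplicity r (order G))"
  proof (intro prod.mono_neutral_left)
    show "prime_factors (order G) \<subseteq> {p, q}"
      using Y(2) by (auto simp: pq D_def in_prime_factors_iff)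
    show "\<forall>r\<in>{p, q} - prime_factors (order G). r ^ multiplicity r (order G) = 1"
      using primes pos by (auto simp: in_prime_factors_iff not_dvd_imp_multiplicity_0)
  qed auto
  also have "\<dots> = ?a * ?b" using pq(2) by simp
  finally have order: "order G = ?a * ?b" .
  obtain P where P: "subgroup P G" "card P = ?a"
    using sylow_thm[OF primes(1) group_axioms order fin] by blast
  obtain Q where Q: "subgroup Q G" "card Q = ?b"
    using sylow_thm[OF primes(2) group_axioms _ fin, of _ ?a] order by (metis mult.commute)
  have comm: "comm_group (G\<lparr>carrier := P\<rparr>)" "comm_group (G\<lparr>carrier := Q\<rparr>)"
    using assms(1) P Q primes unfolding A_group_def sylow_subgroup_def by blast+
  have cop: "coprime (card P) (card Q)"
    using P Q primes pq by (simp add: primes_coprime)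
  interpret PQ: group_disjoint_sum G P Q
    by (rule group_disjoint_sum.intro[OF group_axioms P(1) Q(1)])
  have "P \<inter> Q \<subseteq> {\<one>}"
    using coprime_card_Int[OF P(1) Q(1) cop] by blast
  then have "inj_on (\<lambda>(x, y). x \<otimes> y) (P \<times> Q)"
    unfolding PQ.cancel inj_on_def by auto
  moreover have "(\<lambda>(x, y). x \<otimes> y) ` (P \<times> Q) \<subseteq> carrier G" by auto
  moreover have "card (P \<times> Q) = card (carrier G)"
    unfolding card_cartesian_product P(2) Q(2) order[symmetric] by (simp add: order_def)
  ultimately have "(\<lambda>(x, y). x \<otimes> y) ` (P \<times> Q) = carrier G"
    using fin by (intro card_subset_eq) (simp_all add: card_image)
  then have "g \<in> (\<lambda>(x, y). x \<otimes> y) ` (P \<times> Q)" if "g \<in> carrier G" for g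
    using that by simp
  then have "\<exists>x\<in>P. \<exists>y\<in>Q. g = x \<otimes> y" if "g \<in> carrier G" for g
    using that by fast
  then have "abelian_factorization G P Q"
    using comm_groupE(4)[OF comm(1)] comm_groupE(4)[OF comm(2)]
    by (intro abelian_factorization.intro abelian_factorization_axioms.intro
        group_axioms fin P(1) Q(1) cop) simp_all
  then show ?thesis by (rule that)
qed

theorem proposition2p1:
  fixes G :: "('a, 'b) monoid_scheme"
  assumes "A_group G"
    and "card {p :: nat. Factorial_Ring.prime p \<and> p dvd order G} \<le> 2"
  shows "A'_group G"
proof -
  obtain P Q where "abelian_factorization G P Q"
    using A_group_abelian_factorization[OF assms] by blast
  then interpret abelian_factorization G P Q .
  obtain H :: "nat monoid" and f where H: "group H" "f \<in> iso G H"
    using nat_copy[OF finite_G] by blast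
  then have "A'_group_nat H"
    using A'_group_nat_abelian_factorization image_iso by blast
  then show ?thesis
    using H group_axioms unfolding A'_group_def is_iso_def by blast
qed

end
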